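(* Let $S=S(G,\sigma)$ be a signed graph with underlying graph $G$ (finite, simple, undirected and connected). Then: (i) $M_1(G)=M_1(S)+4M_1^{\ast}(S)$; (ii) $M_2(G)=M_2(S)+2M_2^{\ast}(S)$.
   Context: All graphs are finite, simple, undirected and connected. A signed graph $S=S(G,\sigma)$ is a graph $G$ with vertex set $V(G)=\{v_1,\dots,v_n\}$ and edge set $E(G)$ together with a function $\sigma:E(G)\to\{+,-\}$; $G$ is its underlying graph, and $V(S)=V(G)$, $E(S)=E(G)$. For a vertex $v_i$, $d_i=d_G(v_i)$ is its degree in $G$, $d_i^+$ is the number of positive edges incident with $v_i$, $d_i^-$ is the number of negative edges incident with $v_i$, and $\hat d_i=d_i^+-d_i^-$ is its net-degree. Zagreb indices of $G$: $M_1(G)=\sum_{v_i\in V(G)}d_i^2$ and $M_2(G)=\sum_{v_iv_j\in E(G)}d_id_j$ (each edge counted once). Zagreb net-indices of $S$: $M_1(S)=\sum_{v_i\in V(S)}\hat d_i^{\,2}$ and $M_2(S)=\sum_{v_iv_j\in E(S)}\hat d_i\hat d_j$ (each edge counted once). Mixed Zagreb indices of $S$: $M_1^{\ast}(S)=\sum_{v_i\in V(G)}d_i^+d_i^-$; and $M_2^{\ast}(S)$ is the sum of $d_i^+d_j^-$ over all ordered pairs $(i,j)$, $i\ne j$, with $v_iv_j\in E(G)$, i.e. $M_2^{\ast}(S)=\sum_{v_iv_j\in E(G)}(d_i^+d_j^-+d_i^-d_j^+)$ with each edge counted once. *)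

theory Defs
  imports "Graph_Theory.Graph_Theory"
begin

text \<open>
  A finite simple undirected graph is a \<^locale>\<open>pair_graph\<close>: a finite loop-free digraph whose arcs
  are ordered pairs and whose arc relation is symmetric, so each edge \<open>uv\<close> is
  represented by the two arcs \<open>(u, v)\<close> and \<open>(v, u)\<close>.
  Signs live on undirected edges, taken as two-element vertex sets; the values of a signature
  outside the edge set of the graph are irrelevant.
\<close>

datatype sign = Positive | Negative

type_synonym 'a signature = "'a set \<Rightarrow> sign"

definition uedges :: "'a pair_pre_digraph \<Rightarrow> 'a set set" where
  "uedges G = {{u, v} | u v. (u, v) \<in> parcs G}"

definition vertex_degree :: "'a pair_pre_digraph \<Rightarrow> 'a \<Rightarrow> nat" where
  "vertex_degree G v = card {e \<in> uedges G. v \<in> e}"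

definition pos_degree :: "'a pair_pre_digraph \<Rightarrow> 'a signature \<Rightarrow> 'a \<Rightarrow> nat" where
  "pos_degree G \<sigma> v = card {e \<in> uedges G. v \<in> e \<and> \<sigma> e = Positive}"

definition neg_degree :: "'a pair_pre_digraph \<Rightarrow> 'a signature \<Rightarrow> 'a \<Rightarrow> nat" where
  "neg_degree G \<sigma> v = card {e \<in> uedges G. v \<in> e \<and> \<sigma> e = Negative}"

definition net_degree :: "'a pair_pre_digraph \<Rightarrow> 'a signature \<Rightarrow> 'a \<Rightarrow> int" where
  "net_degree G \<sigma> v = int (pos_degree G \<sigma> v) - int (neg_degree G \<sigma> v)"

text \<open>
  In the second indices the product over the two ends of an edge \<open>e = {u, v}\<close>
  renders the unordered product of the values at \<open>u\<close> and \<open>v\<close>, and each edge is counted once.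
\<close>

definition zagreb1 :: "'a pair_pre_digraph \<Rightarrow> nat" where
  "zagreb1 G = (\<Sum>v\<in>pverts G. (vertex_degree G v)\<^sup>2)"

definition zagreb2 :: "'a pair_pre_digraph \<Rightarrow> nat" where
  "zagreb2 G = (\<Sum>e\<in>uedges G. \<Prod>v\<in>e. vertex_degree G v)"

definition net_zagreb1 :: "'a pair_pre_digraph \<Rightarrow> 'a signature \<Rightarrow> int" where
  "net_zagreb1 G \<sigma> = (\<Sum>v\<in>pverts G. (net_degree G \<sigma> v)\<^sup>2)"

definition net_zagreb2 :: "'a pair_pre_digraph \<Rightarrow> 'a signature \<Rightarrow> int" where
  "net_zagreb2 G \<sigma> = (\<Sum>e\<in>uedges G. \<Prod>v\<in>e. net_degree G \<sigma> v)"

definition mixed_zagreb1 :: "'a pair_pre_digraph \<Rightarrow> 'a signature \<Rightarrow> nat" where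
  "mixed_zagreb1 G \<sigma> = (\<Sum>v\<in>pverts G. pos_degree G \<sigma> v * neg_degree G \<sigma> v)"

text \<open>Summing over arcs is summing over the ordered pairs of adjacent vertices.\<close>

definition mixed_zagreb2 :: "'a pair_pre_digraph \<Rightarrow> 'a signature \<Rightarrow> nat" where
  "mixed_zagreb2 G \<sigma> = (\<Sum>(u, v)\<in>parcs G. pos_degree G \<sigma> u * neg_degree G \<sigma> v)"

end

theory Submission
  imports Defs
begin

text \<open>
  At every vertex the degree is the sum, and the net-degree the difference, of the positive degree
  \<open>p\<close> and the negative degree \<open>n\<close>. Both identities are then polynomial identities summed over
  the graph. The first one is \<open>(p + n)\<^sup>2 = (p - n)\<^sup>2 + 4 p n\<close> at each vertex.
  For the second, at the ends \<open>u\<close>, \<open>v\<close> of an edge, with subscripts for the vertex,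
  \<open>(p\<^sub>u + n\<^sub>u) (p\<^sub>v + n\<^sub>v) = (p\<^sub>u - n\<^sub>u) (p\<^sub>v - n\<^sub>v) + 2 (p\<^sub>u n\<^sub>v + p\<^sub>v n\<^sub>u)\<close>,
  where the last bracket is what the two arcs carried by the edge contribute to the mixed index
  (lemma \<open>sum_arcs_eq_sum_edges\<close>).
\<close>

lemma (in pair_graph) finite_uedges: "finite (uedges G)"
proof -
  have "uedges G = (\<lambda>(u, v). {u, v}) ` parcs G"
    unfolding uedges_def by auto
  then show ?thesis
    using pair_finite_arcs by simp
qed

lemma (in pair_graph) vertex_degree_eq_pos_plus_neg:
  "vertex_degree G v = pos_degree G \<sigma> v + neg_degree G \<sigma> v"
proof -
  have "{e \<in> uedges G. v \<in> e} =
      {e \<in> uedges G. v \<in> e \<and> \<sigma> e = Positive} \<union> {e \<in> uedges G. v \<in> e \<and> \<sigma> e = Negative}"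
    by (auto intro: sign.exhaust)
  then show ?thesis
    unfolding vertex_degree_def pos_degree_def neg_degree_def
    using finite_uedges by (auto simp: card_Un_disjoint disjoint_iff)
qed

lemma (in pair_graph) uedge_cases:
  assumes "e \<in> uedges G"
  obtains u v where "e = {u, v}" "u \<noteq> v" "(u, v) \<in> parcs G" "(v, u) \<in> parcs G"
proof -
  obtain u v where uv: "e = {u, v}" "(u, v) \<in> parcs G"
    using assms unfolding uedges_def by auto
  moreover have "u \<noteq> v"
    using pair_no_loops[OF uv(2)] by simp
  moreover have "(v, u) \<in> parcs G"
    using arcs_symmetric uv(2) by blast
  ultimately show thesis
    using that by blast
qed

text \<open>
  The map sending an arc to its pair of ends is two-to-one onto the edges. A summand that is not
  symmetric in the two ends has no value on an edge alone, so the regrouping is expressed through a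
  function \<open>g\<close> of edges that already adds up both orientations.
\<close>

lemma (in pair_graph) sum_arcs_eq_sum_edges:
  fixes f :: "'a \<Rightarrow> 'a \<Rightarrow> 'b::comm_monoid_add"
  assumes g: "\<And>u v. (u, v) \<in> parcs G \<Longrightarrow> g {u, v} = f u v + f v u"
  shows "(\<Sum>(u, v)\<in>parcs G. f u v) = (\<Sum>e\<in>uedges G. g e)"
proof -
  have "(\<Sum>(u, v)\<in>parcs G. f u v) =
      (\<Sum>e\<in>uedges G. \<Sum>(u, v)\<in>{a \<in> parcs G. (case a of (u, v) \<Rightarrow> {u, v}) = e}. f u v)"
    by (rule sum.group[symmetric])
      (use pair_finite_arcs finite_uedges in \<open>auto simp: uedges_def\<close>)
  also have "\<dots> = (\<Sum>e\<in>uedges G. g e)"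
  proof (rule sum.cong)
    fix e assume "e \<in> uedges G"
    then obtain u v where uv: "e = {u, v}" "u \<noteq> v" "(u, v) \<in> parcs G" "(v, u) \<in> parcs G"
      by (rule uedge_cases)
    have "{a \<in> parcs G. (case a of (u, v) \<Rightarrow> {u, v}) = e} = {(u, v), (v, u)}"
      using uv by (auto simp: doubleton_eq_iff)
    then show "(\<Sum>(u, v)\<in>{a \<in> parcs G. (case a of (u, v) \<Rightarrow> {u, v}) = e}. f u v) = g e"
      using uv g by simp
  qed simp
  finally show ?thesis .
qed

lemma (in pair_graph) zagreb1_eq_net_plus_mixed:
  "int (zagreb1 G) = net_zagreb1 G \<sigma> + 4 * int (mixed_zagreb1 G \<sigma>)"
  unfolding zagreb1_def net_zagreb1_def mixed_zagreb1_def net_degree_def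
    vertex_degree_eq_pos_plus_neg[of _ \<sigma>]
  by (simp add: sum_distrib_left sum.distrib[symmetric] power2_eq_square algebra_simps)

lemma (in pair_graph) zagreb2_eq_net_plus_mixed:
  "int (zagreb2 G) = net_zagreb2 G \<sigma> + 2 * int (mixed_zagreb2 G \<sigma>)"
proof -
  let ?d = "\<lambda>v. int (vertex_degree G v)" and ?net = "net_degree G \<sigma>"
  have "(\<Sum>(u, v)\<in>parcs G. 2 * (int (pos_degree G \<sigma> u) * int (neg_degree G \<sigma> v))) =
      (\<Sum>e\<in>uedges G. (\<Prod>v\<in>e. ?d v) - (\<Prod>v\<in>e. ?net v))"
  proof (rule sum_arcs_eq_sum_edges)
    fix u v assume "(u, v) \<in> parcs G"
    then have "u \<noteq> v"
      using pair_no_loops by fastforce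
    then show "(\<Prod>v\<in>{u, v}. ?d v) - (\<Prod>v\<in>{u, v}. ?net v) =
        2 * (int (pos_degree G \<sigma> u) * int (neg_degree G \<sigma> v)) +
        2 * (int (pos_degree G \<sigma> v) * int (neg_degree G \<sigma> u))"
      by (simp add: net_degree_def vertex_degree_eq_pos_plus_neg[of _ \<sigma>] algebra_simps)
  qed
  also have "\<dots> = int (zagreb2 G) - net_zagreb2 G \<sigma>"
    by (simp add: zagreb2_def net_zagreb2_def sum_subtractf)
  finally show ?thesis
    by (simp add: mixed_zagreb2_def sum_distrib_left case_prod_unfold)
qed

theorem theorem3:
  fixes G :: "'a pair_pre_digraph" and \<sigma> :: "'a signature"
  assumes "pair_graph G" and "connected (with_proj G)"
  shows "int (zagreb1 G) = net_zagreb1 G \<sigma> + 4 * int (mixed_zagreb1 G \<sigma>) \<and>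
         int (zagreb2 G) = net_zagreb2 G \<sigma> + 2 * int (mixed_zagreb2 G \<sigma>)"
proof -
  interpret pair_graph G by fact
  show ?thesis
    using zagreb1_eq_net_plus_mixed zagreb2_eq_net_plus_mixed by blast
qed

end
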